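(* The bivariate generating function $\mathit{Total}(z,u)$ of partial alternate Łukasiewicz paths, where $z$ marks the length and $u$ marks the height of the end point, is $$\mathit{Total}(z,u)=\frac{s_1^2z^2+s_1uz^2+2s_1z^3+s_1^2-s_1u+zs_1+z^2}{(z^2+1)(-u+s_1)s_1}.$$ Moreover, $$[u^0]\mathit{Total}(z,u)=\frac{s_1^2z^2+2s_1z^3+s_1^2+s_1z+z^2}{(z^2+1)s_1^2},$$ and for $k\ge1$, $$[u^k]\mathit{Total}(z,u)=\frac{z\,(2s_1^2z+2s_1z^2+s_1+z)}{(z^2+1)s_1^{k+2}}.$$
   Context: A partial Łukasiewicz path of length $n\ge 0$ is a lattice path starting at $(0,0)$, consisting of $n$ steps from $\{(1,j): j\ge -1\}$, and never going below the $x$-axis. The step $(1,-1)$ is a down-step, $(1,0)$ is a horizontal step, and $(1,j)$ with $j\ge1$ is an up-step; these are the three possible directions of a step. A partial alternate Łukasiewicz path is a partial Łukasiewicz path that does not contain two consecutive steps with the same direction (i.e. no two consecutive up-steps, even of different sizes, no two consecutive horizontal steps, no two consecutive down-steps). The empty path is included. The height of the end point is its $y$-coordinate; $[u^k]$ denotes coefficient extraction. $s_1$ is the power series in $z$ (with constant term $1$) $$s_1=\frac{1-2z^3+\sqrt{4z^6-4z^4-4z^3-4z^2+1}}{2z^2+2},$$ where the square root is the power series with constant term $1$. *)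

theory Defs
  imports "HOL-Computational_Algebra.Formal_Power_Series" "HOL-Library.Product_Plus"
begin

definition luka_steps :: "(int \<times> int) set" where
  "luka_steps = {(1, j) | j. j \<ge> -1}"

text \<open>A path starting at the origin is given by its list of steps; the points it visits
  are the sums of the prefixes of that list.\<close>

definition partial_luka_path :: "(int \<times> int) list \<Rightarrow> bool" where
  "partial_luka_path p \<longleftrightarrow>
     set p \<subseteq> luka_steps \<and> (\<forall>i\<le>length p. snd (sum_list (take i p)) \<ge> 0)"

datatype direction = Down | Horizontal | Up

definition step_direction :: "int \<times> int \<Rightarrow> direction" where
  "step_direction s = (if snd s < 0 then Down else if snd s = 0 then Horizontal else Up)"

definition partial_alternate_luka_path :: "(int \<times> int) list \<Rightarrow> bool" where
  "partial_alternate_luka_path p \<longleftrightarrow>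
     partial_luka_path p \<and> successively (\<lambda>s t. step_direction s \<noteq> step_direction t) p"

definition end_height :: "(int \<times> int) list \<Rightarrow> int" where
  "end_height p = snd (sum_list p)"

definition alternate_luka_paths :: "nat \<Rightarrow> nat \<Rightarrow> (int \<times> int) list set" where
  "alternate_luka_paths n k =
     {p. partial_alternate_luka_path p \<and> length p = n \<and> end_height p = int k}"

text \<open>Up-steps are unbounded, so there are infinitely many paths of a given positive length,
  but only finitely many once the final height is fixed too. Hence the cardinalities in
  \<open>Total\<close> below are genuine counts.\<close>

lemma sum_list_bounds:
  fixes xs :: "int list"
  assumes "\<forall>x\<in>set xs. -1 \<le> x"
  shows "- int (length xs) \<le> sum_list xs" "\<forall>x\<in>set xs. x \<le> sum_list xs + int (length xs)"
  using assms by (induction xs) force+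

lemma snd_sum_list: "snd (sum_list p) = sum_list (map snd p)"
  by (induction p) auto

lemma finite_alternate_luka_paths: "finite (alternate_luka_paths n k)"
proof (rule finite_subset)
  let ?S = "{1} \<times> {-1..int k + int n}"
  show "alternate_luka_paths n k \<subseteq> {p. set p \<subseteq> ?S \<and> length p = n}"
  proof
    fix p assume "p \<in> alternate_luka_paths n k"
    then have p: "set p \<subseteq> luka_steps" "length p = n" "sum_list (map snd p) = int k"
      by (auto simp: alternate_luka_paths_def partial_alternate_luka_path_def
          partial_luka_path_def end_height_def snd_sum_list)
    then have ge: "\<forall>x\<in>set (map snd p). -1 \<le> x"
      by (auto simp: luka_steps_def)
    from sum_list_bounds(2)[OF ge] p ge show "p \<in> {p. set p \<subseteq> ?S \<and> length p = n}"
      by (fastforce simp: luka_steps_def)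
  qed
  show "finite {p. set p \<subseteq> ?S \<and> length p = n}"
    by (rule finite_lists_length_eq) simp
qed

text \<open>Bivariate series are power series in \<open>u\<close> whose coefficients are power series in \<open>z\<close>:
  \<open>u\<close> is the outer \<^term>\<open>fps_X\<close>, \<open>z\<close> is \<^term>\<open>fps_const fps_X\<close>, and
  the coefficient of \<open>u ^ k\<close> in \<open>F\<close> is \<^term>\<open>fps_nth F k\<close>.\<close>

definition Total :: "real fps fps" where
  "Total = Abs_fps (\<lambda>k. Abs_fps (\<lambda>n. of_nat (card (alternate_luka_paths n k))))"

text \<open>If \<open>f\<close> has positive constant term, \<^term>\<open>fps_radical root 2 f\<close> is the square root of \<open>f\<close> whose constant term
  is the real square root of that of \<open>f\<close>.\<close>

definition s1_radicand :: "real fps" where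
  "s1_radicand = 4 * fps_X ^ 6 - 4 * fps_X ^ 4 - 4 * fps_X ^ 3 - 4 * fps_X ^ 2 + 1"

definition s1 :: "real fps" where
  "s1 = (1 - 2 * fps_X ^ 3 + fps_radical root 2 s1_radicand) / (2 * fps_X ^ 2 + 2)"

lemma s1_radicand_nth_0: "fps_nth s1_radicand 0 = 1"
  by (simp add: s1_radicand_def)

lemma radical_s1_radicand:
  "fps_radical root 2 s1_radicand ^ 2 = s1_radicand"
  "fps_nth (fps_radical root 2 s1_radicand) 0 = 1"
  using power_radical[of s1_radicand root 1]
  by (simp_all add: s1_radicand_nth_0 numeral_2_eq_2)

lemma s1_nth_0: "fps_nth s1 0 = 1"
  by (simp add: s1_def fps_divide_unit s1_radicand_nth_0)

text \<open>Division by a bivariate series is an actual quotient as soon as its coefficient of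
  \<open>u ^ 0\<close> is an invertible series in \<open>z\<close>, as for the denominator of the closed form of \<open>Total\<close>.\<close>

lemma fps_fps_divide_mult:
  fixes f g :: "real fps fps"
  assumes "fps_nth (fps_nth g 0) 0 \<noteq> 0"
  shows "f / g * g = f"
proof -
  have 0: "fps_nth g 0 \<noteq> 0"
    using assms by auto
  have "fps_nth g 0 * inverse (fps_nth g 0) = 1"
    by (rule inverse_mult_eq_1') (rule assms)
  then have "inverse g * g = 1"
    unfolding fps_inverse_def[of g] by (subst mult.commute) (rule fps_right_inverse)
  then show ?thesis
    by (simp add: fps_divide_unit[OF 0] mult.assoc)
qed

lemma Total_denominator_unit:
  "fps_nth (fps_nth ((fps_const fps_X ^ 2 + 1) * (- fps_X + fps_const s1) * fps_const s1) 0) 0 = 1"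
  by (simp add: s1_nth_0)

end

theory Submission
  imports Defs
begin

text \<open>The proof is an instance of the kernel method. Split the nonempty paths by the direction of
  their last step, with series \<open>H\<close>, \<open>U\<close>, \<open>D\<close> in \<open>z\<close> and \<open>u\<close>, and write \<open>T\<close> for \<open>Total\<close>. A path
  ending in direction \<open>d\<close> is a path not ending in \<open>d\<close>, followed by a step of direction \<open>d\<close>. An
  up-step may have any positive size, and a down-step cannot follow a path that ends on the axis,
  so
  \<open>H = z (T - H)\<close>, \<open>U = z u / (1 - u) (T - U)\<close>, \<open>D = z / u (T - D - c)\<close>,
  where \<open>c\<close> is the coefficient of \<open>u ^ 0\<close> in \<open>T - D\<close>. Eliminating \<open>H\<close>, \<open>U\<close>, \<open>D\<close> from
  \<open>T = 1 + H + U + D\<close> gives (\<open>kernel_elimination\<close>)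

  \<open>((1 - 2 z ^ 3) u - (z ^ 2 + 1) u ^ 2 - z ^ 2) T = (1 + z) (1 - (1 - z) u) (u + z - z c)\<close>.

  The kernel on the left is \<open>(z ^ 2 + 1) (s1 - u) (u - s2)\<close>, where \<open>s1\<close> is the root with constant
  term \<open>1\<close> and \<open>s2\<close> the one with constant term \<open>0\<close>. At \<open>u = s2\<close> the left-hand side vanishes,
  hence so does \<open>s2 + z - z c\<close>; this determines the unknown \<open>c\<close> and turns the last factor on the
  right into \<open>u - s2\<close>. Cancelling it leaves (\<open>Total_rational\<close>)

  \<open>(z ^ 2 + 1) (s1 - u) T = (1 + z) (1 - (1 - z) u)\<close>.

  The three closed forms are this identity and its coefficients in \<open>u\<close>, rewritten by means of the
  quadratic equation of \<open>s1\<close>.\<close>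

section \<open>Decomposing a path at its last step\<close>

definition paths_ending :: "direction \<Rightarrow> nat \<Rightarrow> nat \<Rightarrow> (int \<times> int) list set" where
  "paths_ending d n k = {p \<in> alternate_luka_paths n k. p \<noteq> [] \<and> step_direction (last p) = d}"

text \<open>These are the paths that a step of direction \<open>d\<close> may follow without repeating a direction;
  the empty path is among them for every \<open>d\<close>.\<close>

definition paths_avoiding :: "direction \<Rightarrow> nat \<Rightarrow> nat \<Rightarrow> (int \<times> int) list set" where
  "paths_avoiding d n k = alternate_luka_paths n k - paths_ending d n k"

lemma paths_ending_subset: "paths_ending d n k \<subseteq> alternate_luka_paths n k"
  by (auto simp: paths_ending_def)

lemma finite_paths_ending: "finite (paths_ending d n k)"
  by (rule finite_subset[OF paths_ending_subset finite_alternate_luka_paths])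

lemma finite_paths_avoiding: "finite (paths_avoiding d n k)"
  by (simp add: paths_avoiding_def finite_alternate_luka_paths)

lemma paths_ending_0: "paths_ending d 0 k = {}"
  by (auto simp: paths_ending_def alternate_luka_paths_def)

lemma alternate_luka_paths_0: "alternate_luka_paths 0 k = (if k = 0 then {[]} else {})"
  by (auto simp: alternate_luka_paths_def partial_alternate_luka_path_def partial_luka_path_def
      end_height_def)

lemma end_height_snoc: "end_height (p @ [s]) = end_height p + snd s"
  by (simp add: end_height_def)

lemma partial_alternate_luka_path_snoc:
  "partial_alternate_luka_path (p @ [s]) \<longleftrightarrow>
     partial_alternate_luka_path p \<and> s \<in> luka_steps \<and> end_height p + snd s \<ge> 0 \<and>
     (p = [] \<or> step_direction (last p) \<noteq> step_direction s)"
proof -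
  have "(\<forall>i\<le>length (p @ [s]). snd (sum_list (take i (p @ [s]))) \<ge> 0) \<longleftrightarrow>
        (\<forall>i\<le>length p. snd (sum_list (take i p)) \<ge> 0) \<and> end_height p + snd s \<ge> 0"
    by (auto simp: le_Suc_eq end_height_def)
  then show ?thesis
    by (auto simp: partial_alternate_luka_path_def partial_luka_path_def successively_append_iff)
qed

lemma end_height_nonneg: "partial_alternate_luka_path p \<Longrightarrow> end_height p \<ge> 0"
  by (auto simp: partial_alternate_luka_path_def partial_luka_path_def end_height_def)

lemma snoc_in_alternate_luka_paths:
  "p @ [s] \<in> alternate_luka_paths (Suc n) k \<longleftrightarrow>
     s \<in> luka_steps \<and> (\<exists>i. int i + snd s = int k \<and> p \<in> paths_avoiding (step_direction s) n i)"
proof -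
  have "\<exists>i. end_height p = int i" if "partial_alternate_luka_path p"
    using end_height_nonneg[OF that] nonneg_int_cases by metis
  then show ?thesis
    by (auto simp: alternate_luka_paths_def paths_avoiding_def paths_ending_def
        partial_alternate_luka_path_snoc end_height_snoc)
qed

lemma in_paths_ending_Suc:
  "q \<in> paths_ending d (Suc n) k \<longleftrightarrow>
     (\<exists>p j i. q = p @ [(1, j)] \<and> j \<ge> -1 \<and> step_direction (1, j) = d \<and>
            int i + j = int k \<and> p \<in> paths_avoiding d n i)"
proof (cases q rule: rev_cases)
  case Nil
  then show ?thesis
    by (simp add: paths_ending_def)
next
  case (snoc p s)
  have "q \<in> paths_ending d (Suc n) k \<longleftrightarrow>
      q \<in> alternate_luka_paths (Suc n) k \<and> step_direction s = d"
    by (simp add: paths_ending_def snoc)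
  also have "\<dots> \<longleftrightarrow> s \<in> luka_steps \<and> step_direction s = d \<and>
      (\<exists>i. int i + snd s = int k \<and> p \<in> paths_avoiding d n i)"
    unfolding snoc snoc_in_alternate_luka_paths by auto
  finally show ?thesis
    by (cases s) (auto simp: snoc luka_steps_def)
qed

lemma paths_ending_Horizontal:
  "paths_ending Horizontal (Suc n) k = (\<lambda>p. p @ [(1, 0)]) ` paths_avoiding Horizontal n k"
  by (auto simp: in_paths_ending_Suc step_direction_def image_iff split: if_splits)

lemma paths_ending_Down:
  "paths_ending Down (Suc n) k = (\<lambda>p. p @ [(1, -1)]) ` paths_avoiding Down n (Suc k)"
proof (intro set_eqI)
  fix q
  have "step_direction (1, j) = Down \<and> j \<ge> -1 \<and> int i + j = int k \<longleftrightarrow> j = -1 \<and> i = Suc k" for i j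
    by (auto simp: step_direction_def split: if_splits)
  then show "q \<in> paths_ending Down (Suc n) k \<longleftrightarrow>
      q \<in> (\<lambda>p. p @ [(1, -1)]) ` paths_avoiding Down n (Suc k)"
    unfolding in_paths_ending_Suc image_iff by (metis (no_types, lifting))
qed

lemma paths_ending_Up:
  "paths_ending Up (Suc n) k =
     (\<Union>i<k. (\<lambda>p. p @ [(1, int k - int i)]) ` paths_avoiding Up n i)"
proof (intro set_eqI)
  fix q
  have "step_direction (1, j) = Up \<and> j \<ge> -1 \<and> int i + j = int k \<longleftrightarrow> j = int k - int i \<and> i < k" for i j
    by (auto simp: step_direction_def split: if_splits)
  then show "q \<in> paths_ending Up (Suc n) k \<longleftrightarrow>
      q \<in> (\<Union>i<k. (\<lambda>p. p @ [(1, int k - int i)]) ` paths_avoiding Up n i)"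
    unfolding in_paths_ending_Suc image_iff UN_iff by (metis (no_types, lifting) lessThan_iff)
qed

lemma card_paths_ending_Horizontal:
  "card (paths_ending Horizontal (Suc n) k) = card (paths_avoiding Horizontal n k)"
  by (simp add: paths_ending_Horizontal card_image inj_on_def)

lemma card_paths_ending_Down:
  "card (paths_ending Down (Suc n) k) = card (paths_avoiding Down n (Suc k))"
  by (simp add: paths_ending_Down card_image inj_on_def)

lemma card_paths_ending_Up:
  "card (paths_ending Up (Suc n) k) = (\<Sum>i<k. card (paths_avoiding Up n i))"
proof -
  have "card (paths_ending Up (Suc n) k) =
      (\<Sum>i<k. card ((\<lambda>p. p @ [(1, int k - int i)]) ` paths_avoiding Up n i))"
    unfolding paths_ending_Up
    by (rule card_UN_disjoint) (auto simp: finite_paths_avoiding)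
  then show ?thesis
    by (simp add: card_image inj_on_def)
qed

lemma card_alternate_luka_paths_split:
  "card (alternate_luka_paths n k) = of_bool (n = 0 \<and> k = 0) +
     (card (paths_ending Horizontal n k) + card (paths_ending Up n k) + card (paths_ending Down n k))"
proof (cases "n = 0")
  case True
  then show ?thesis
    by (simp add: alternate_luka_paths_0 paths_ending_0)
next
  case False
  let ?E = "\<lambda>d. paths_ending d n k"
  have "alternate_luka_paths n k = (?E Horizontal \<union> ?E Up) \<union> ?E Down"
    using False direction.exhaust
    by (auto simp: paths_ending_def alternate_luka_paths_def)
  also have "card \<dots> = card (?E Horizontal) + card (?E Up) + card (?E Down)"
    by (subst card_Un_disjoint; (subst card_Un_disjoint)?)
      (auto simp: paths_ending_def finite_alternate_luka_paths)
  finally show ?thesis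
    using False by simp
qed

section \<open>The functional equations\<close>

definition ending_series :: "direction \<Rightarrow> real fps fps" where
  "ending_series d = Abs_fps (\<lambda>k. Abs_fps (\<lambda>n. of_nat (card (paths_ending d n k))))"

lemma nth_ending_series:
  "fps_nth (fps_nth (ending_series d) k) n = of_nat (card (paths_ending d n k))"
  by (simp add: ending_series_def)

lemma nth_Total_minus_ending_series:
  "fps_nth (fps_nth (Total - ending_series d) k) n = of_nat (card (paths_avoiding d n k))"
proof -
  have "card (paths_ending d n k) \<le> card (alternate_luka_paths n k)"
    by (rule card_mono[OF finite_alternate_luka_paths paths_ending_subset])
  moreover have "card (paths_avoiding d n k) =
      card (alternate_luka_paths n k) - card (paths_ending d n k)"
    unfolding paths_avoiding_def
    by (rule card_Diff_subset[OF finite_paths_ending paths_ending_subset])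
  ultimately show ?thesis
    by (simp add: Total_def ending_series_def of_nat_diff)
qed

lemma Total_eq_sum_ending_series:
  "Total = 1 + (ending_series Horizontal + ending_series Up + ending_series Down)"
  by (intro fps_ext)
    (auto simp: Total_def ending_series_def card_alternate_luka_paths_split)

lemma nth_ending_series_Horizontal:
  "fps_nth (ending_series Horizontal) k = fps_X * fps_nth (Total - ending_series Horizontal) k"
proof (rule fps_ext)
  fix n
  show "fps_nth (fps_nth (ending_series Horizontal) k) n =
      fps_nth (fps_X * fps_nth (Total - ending_series Horizontal) k) n"
    by (cases n) (simp_all add: nth_ending_series paths_ending_0 card_paths_ending_Horizontal
        nth_Total_minus_ending_series del: fps_sub_nth)
qed

lemma nth_ending_series_Down:
  "fps_nth (ending_series Down) k = fps_X * fps_nth (Total - ending_series Down) (Suc k)"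
proof (rule fps_ext)
  fix n
  show "fps_nth (fps_nth (ending_series Down) k) n =
      fps_nth (fps_X * fps_nth (Total - ending_series Down) (Suc k)) n"
    by (cases n) (simp_all add: nth_ending_series paths_ending_0 card_paths_ending_Down
        nth_Total_minus_ending_series del: fps_sub_nth)
qed

lemma nth_ending_series_Up:
  "fps_nth (ending_series Up) k = fps_X * (\<Sum>i<k. fps_nth (Total - ending_series Up) i)"
proof (rule fps_ext)
  fix n
  show "fps_nth (fps_nth (ending_series Up) k) n =
      fps_nth (fps_X * (\<Sum>i<k. fps_nth (Total - ending_series Up) i)) n"
    by (cases n) (simp_all add: nth_ending_series paths_ending_0 card_paths_ending_Up
        nth_Total_minus_ending_series fps_sum_nth del: fps_sub_nth)
qed

lemma ending_series_Horizontal: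
  "ending_series Horizontal = fps_const fps_X * (Total - ending_series Horizontal)"
  by (rule fps_ext) (simp add: nth_ending_series_Horizontal[symmetric] del: fps_sub_nth)

text \<open>Multiplying by \<open>1 - u\<close> turns the sum over all lower heights into a single term.\<close>

lemma ending_series_Up:
  "(1 - fps_X) * ending_series Up = fps_const fps_X * fps_X * (Total - ending_series Up)"
proof -
  define A where "A = Total - ending_series Up"
  have nth: "fps_nth (ending_series Up) k = fps_X * (\<Sum>i<k. fps_nth A i)" for k
    unfolding A_def by (rule nth_ending_series_Up)
  have "fps_nth ((1 - fps_X) * ending_series Up) k = fps_nth (fps_const fps_X * fps_X * A) k" for k
    by (cases k) (simp_all add: left_diff_distrib nth mult.assoc distrib_left)
  then show ?thesis
    unfolding A_def by (rule fps_ext)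
qed

text \<open>The constant subtracted on the right counts those paths not ending in a down-step that end on
  the axis: a down-step would take them below it.\<close>

lemma ending_series_Down:
  "fps_X * ending_series Down = fps_const fps_X *
     (Total - ending_series Down - fps_const (fps_nth (Total - ending_series Down) 0))"
proof -
  define A where "A = Total - ending_series Down"
  have nth: "fps_nth (ending_series Down) k = fps_X * fps_nth A (Suc k)" for k
    unfolding A_def by (rule nth_ending_series_Down)
  have "fps_nth (fps_X * ending_series Down) k =
      fps_nth (fps_const fps_X * (A - fps_const (fps_nth A 0))) k" for k
    by (cases k) (simp_all add: nth)
  then show ?thesis
    unfolding A_def by (rule fps_ext)
qed

text \<open>Each hypothesis is linear in one of \<open>H\<close>, \<open>U\<close>, \<open>D\<close>, with factor \<open>1 + z\<close>,
  \<open>1 - (1 - z) * u\<close> and \<open>u + z\<close> respectively. Multiplying the decomposition of \<open>T\<close> by the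
  product of the three factors eliminates \<open>H\<close>, \<open>U\<close>, \<open>D\<close> without any division.\<close>

lemma kernel_elimination:
  fixes T H U D z u c :: "'a :: idom"
  assumes T: "T = 1 + (H + U + D)"
    and H: "H = z * (T - H)"
    and U: "(1 - u) * U = z * u * (T - U)"
    and D: "u * D = z * (T - D - c)"
  shows "((1 - 2 * z ^ 3) * u - (z ^ 2 + 1) * u ^ 2 - z ^ 2) * T =
         (1 + z) * (1 - (1 - z) * u) * (u + z - z * c)"
proof -
  have H': "(1 + z) * H = z * T" using H by algebra
  have U': "(1 - (1 - z) * u) * U = z * u * T" using U by algebra
  have D': "(u + z) * D = z * (T - c)" using D by algebra
  have "(1 + z) * (1 - (1 - z) * u) * (u + z) * T =
      (1 + z) * (1 - (1 - z) * u) * (u + z) * (1 + (H + U + D))"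
    using T by simp
  also have "\<dots> = (1 + z) * (1 - (1 - z) * u) * (u + z) + (1 - (1 - z) * u) * (u + z) * ((1 + z) * H)
    + (1 + z) * (u + z) * ((1 - (1 - z) * u) * U) + (1 + z) * (1 - (1 - z) * u) * ((u + z) * D)"
    by (simp add: algebra_simps)
  finally show ?thesis
    unfolding H' U' D' by algebra
qed

section \<open>Cancelling the small root of the kernel\<close>

lemma fps_eq_0_if_multiple_of_all_powers:
  fixes s f :: "'a :: comm_ring_1 fps"
  assumes "fps_nth s 0 = 0" and "\<And>N. \<exists>g. f = s ^ N * g"
  shows "f = 0"
proof (rule fps_ext)
  fix n
  obtain g where "f = s ^ Suc n * g" using assms(2) by blast
  moreover have "fps_nth (s ^ Suc n) i = 0" if "i \<le> n" for i
    using that assms(1) startsby_zero_power_prefix[of s] by (metis le_imp_less_Suc)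
  ultimately show "fps_nth f n = fps_nth 0 n"
    by (simp add: fps_mult_nth)
qed

text \<open>This replaces the substitution \<open>u = s\<close>, which would make the left-hand side vanish.
  Comparing coefficients of \<open>u ^ (k + 1)\<close> makes each coefficient of \<open>G\<close> equal to \<open>s\<close> times
  the next one, so the first coefficient is divisible by every power of \<open>s\<close> and vanishes. The
  coefficient of \<open>u ^ 0\<close> then gives \<open>e = 0\<close>.\<close>

lemma remainder_at_small_root_eq_0:
  fixes s e :: "'a :: comm_ring_1 fps" and G :: "'a fps fps"
  assumes s: "fps_nth s 0 = 0" and eq: "(fps_X - fps_const s) * G = fps_const e"
  shows "e = 0"
proof -
  have nth: "fps_nth ((fps_X - fps_const s) * G) k = fps_nth (fps_const e) k" for k
    using eq by simp
  have step: "fps_nth G k = s * fps_nth G (Suc k)" for k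
    using nth[of "Suc k"] by (simp add: left_diff_distrib)
  have "fps_nth G 0 = s ^ N * fps_nth G N" for N
  proof (induction N)
    case (Suc N)
    then show ?case
      using step[of N] by (simp add: mult_ac)
  qed simp
  then have "fps_nth G 0 = 0"
    using fps_eq_0_if_multiple_of_all_powers[OF s] by blast
  then show ?thesis
    using nth[of 0] by (simp add: left_diff_distrib)
qed

lemma fps_X_square_plus_1_nonzero: "fps_X ^ 2 + 1 \<noteq> (0 :: real fps)"
proof
  assume "fps_X ^ 2 + 1 = (0 :: real fps)"
  then have "fps_nth (fps_X ^ 2 + 1 :: real fps) 0 = 0" by simp
  then show False by simp
qed

text \<open>Multiplying by \<open>4 * (fps_X ^ 2 + 1)\<close> completes the square, and the discriminant
  \<open>(1 - 2 * fps_X ^ 3) ^ 2 - 4 * fps_X ^ 2 * (fps_X ^ 2 + 1)\<close> is the radicand of \<open>s1\<close>.\<close>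

lemma s1_quadratic: "(fps_X ^ 2 + 1) * s1 ^ 2 = (1 - 2 * fps_X ^ 3) * s1 - fps_X ^ 2"
proof -
  define R where "R = fps_radical root 2 s1_radicand"
  have R: "R ^ 2 = 4 * fps_X ^ 6 - 4 * fps_X ^ 4 - 4 * fps_X ^ 3 - 4 * fps_X ^ 2 + 1"
    using radical_s1_radicand(1) by (simp add: R_def s1_radicand_def)
  have s: "(2 * fps_X ^ 2 + 2) * s1 = 1 - 2 * fps_X ^ 3 + R"
  proof -
    have "fps_nth (2 * fps_X ^ 2 + 2 :: real fps) 0 \<noteq> 0" by simp
    then show ?thesis unfolding s1_def R_def
      by (simp add: fps_divide_unit mult.left_commute inverse_mult_eq_1')
  qed
  have "4 * (fps_X ^ 2 + 1) * ((fps_X ^ 2 + 1) * s1 ^ 2 - ((1 - 2 * fps_X ^ 3) * s1 - fps_X ^ 2)) = 0"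
    using R s by algebra
  then show ?thesis
    unfolding mult_eq_0_iff using fps_X_square_plus_1_nonzero by simp
qed

text \<open>The other root of the kernel in \<open>u\<close>, obtained from the product \<open>z ^ 2 / (z ^ 2 + 1)\<close> of
  the roots, a form that shows that its constant term is \<open>0\<close>.\<close>

definition s2 :: "real fps" where
  "s2 = fps_X ^ 2 / ((fps_X ^ 2 + 1) * s1)"

lemma s2_nth_0: "fps_nth s2 0 = 0"
  by (simp add: s2_def fps_divide_unit s1_nth_0)

lemma kernel_roots_product: "(fps_X ^ 2 + 1) * s1 * s2 = fps_X ^ 2"
proof -
  have "fps_nth ((fps_X ^ 2 + 1) * s1) 0 \<noteq> 0" by (simp add: s1_nth_0)
  then show ?thesis
    by (simp add: s2_def fps_divide_unit mult.left_commute inverse_mult_eq_1')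
qed

lemma kernel_roots_sum: "(fps_X ^ 2 + 1) * (s1 + s2) = 1 - 2 * fps_X ^ 3"
proof -
  have "s1 * ((fps_X ^ 2 + 1) * (s1 + s2)) = s1 * (1 - 2 * fps_X ^ 3)"
    using s1_quadratic kernel_roots_product by algebra
  moreover have "s1 \<noteq> 0" using s1_nth_0 by auto
  ultimately show ?thesis by simp
qed

text \<open>The right-hand side of \<open>kernel_elimination\<close> contains the unknown \<open>c\<close>. Divisibility by
  \<open>u - s2\<close> forces \<open>z * c = s2 + z\<close>, and then \<open>u - s2\<close> cancels.\<close>

lemma Total_rational:
  "(fps_const fps_X ^ 2 + 1) * (fps_const s1 - fps_X) * Total =
     (1 + fps_const fps_X) * (1 - (1 - fps_const fps_X) * fps_X)"
proof -
  define z u s t T where "z = (fps_const fps_X :: real fps fps)" and "u = (fps_X :: real fps fps)"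
    and "s = fps_const s1" and "t = fps_const s2" and "T = Total"
  define c0 where "c0 = fps_nth (Total - ending_series Down) 0"
  define c where "c = fps_const c0"
  define F where "F = (1 + z) * (1 - (1 - z) * u)"
  have kernel: "((1 - 2 * z ^ 3) * u - (z ^ 2 + 1) * u ^ 2 - z ^ 2) * T = F * (u + z - z * c)"
    unfolding z_def u_def c_def T_def c0_def F_def
    by (rule kernel_elimination[OF Total_eq_sum_ending_series ending_series_Horizontal
          ending_series_Up ending_series_Down])
  have prod: "(z ^ 2 + 1) * s * t = z ^ 2"
    using arg_cong[OF kernel_roots_product, of fps_const]
    unfolding z_def s_def t_def
    by (simp flip: numeral_fps_const fps_const_mult fps_const_add fps_const_power)
  have sum: "(z ^ 2 + 1) * (s + t) = 1 - 2 * z ^ 3"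
    using arg_cong[OF kernel_roots_sum, of fps_const]
    unfolding z_def s_def t_def
    by (simp flip: numeral_fps_const fps_const_mult fps_const_add fps_const_sub fps_const_power)
  \<comment> \<open>By the sum and product of the roots, the kernel is \<open>(z ^ 2 + 1) * (s - u) * (u - t)\<close>.\<close>
  define G where "G = (z ^ 2 + 1) * (s - u) * T"
  have factored: "(u - t) * G = F * (u + z - z * c)"
    unfolding G_def using kernel prod sum by algebra
  \<comment> \<open>Since \<open>u + z - z * c = (u - t) + (t + z - z * c)\<close> and \<open>F\<close> is a unit, the second summand,
    which does not depend on \<open>u\<close>, is a multiple of \<open>u - t\<close>.\<close>
  have e: "fps_const (s2 + fps_X - fps_X * c0) = t + z - z * c"
    by (simp add: t_def z_def c_def)
  have "fps_nth (fps_nth F 0) 0 \<noteq> 0"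
    by (simp add: F_def z_def u_def)
  from fps_fps_divide_mult[OF this] have F: "1 / F * F = 1" .
  have "(u - t) * (1 / F * G - 1) = fps_const (s2 + fps_X - fps_X * c0)"
    unfolding e using factored F by algebra
  then have "s2 + fps_X - fps_X * c0 = 0"
    unfolding u_def t_def by (rule remainder_at_small_root_eq_0[OF s2_nth_0])
  then have "t + z - z * c = 0" using e by simp
  then have "(u - t) * G = (u - t) * F"
    using factored by algebra
  moreover have "u - t \<noteq> 0"
  proof
    assume "u - t = 0"
    then have "fps_nth (u - t) 1 = 0" by simp
    then show False by (simp add: u_def t_def)
  qed
  ultimately have "G = F" by simp
  then show ?thesis
    by (simp add: G_def F_def z_def u_def s_def T_def)
qed

section \<open>The closed forms\<close>

text \<open>The right-hand side of \<open>Total_rational\<close> has degree \<open>1\<close> in \<open>u\<close>, so from height \<open>1\<close> on the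
  coefficients form a geometric sequence with ratio \<open>1 / s1\<close>.\<close>

lemma nth_Total_recurrence:
  shows "(fps_X ^ 2 + 1) * s1 * fps_nth Total 0 = 1 + fps_X"
    and "(fps_X ^ 2 + 1) * (s1 * fps_nth Total 1 - fps_nth Total 0) = fps_X ^ 2 - 1"
    and "s1 * fps_nth Total (Suc (Suc k)) = fps_nth Total (Suc k)"
proof -
  have "fps_const (fps_X ^ 2 + 1) * (fps_const s1 * Total - fps_X * Total) =
      fps_const (1 + fps_X) - fps_const (1 - fps_X ^ 2) * fps_X"
    using Total_rational
    by (simp add: algebra_simps power2_eq_square flip: fps_const_mult fps_const_add fps_const_sub fps_const_power)
  then have nth: "(fps_X ^ 2 + 1) * (s1 * fps_nth Total k - fps_nth (fps_X * Total) k) =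
      fps_nth (fps_const (1 + fps_X) - fps_const (1 - fps_X ^ 2) * fps_X) k" for k
    by (metis fps_mult_left_const_nth fps_sub_nth)
  show "(fps_X ^ 2 + 1) * s1 * fps_nth Total 0 = 1 + fps_X"
    using nth[of 0] by (simp add: mult.assoc)
  show "(fps_X ^ 2 + 1) * (s1 * fps_nth Total 1 - fps_nth Total 0) = fps_X ^ 2 - 1"
    using nth[of 1] by simp
  show "s1 * fps_nth Total (Suc (Suc k)) = fps_nth Total (Suc k)"
    using nth[of "Suc (Suc k)"] fps_X_square_plus_1_nonzero by simp
qed

lemma fps_eq_divide_unit:
  fixes f g h :: "'a :: field fps"
  assumes "fps_nth g 0 \<noteq> 0" "f * g = h"
  shows "f = h / g"
  using assms by (auto simp: fps_divide_unit mult.assoc inverse_mult_eq_1')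

theorem theorem7:
  shows "(let z = fps_const fps_X; u = fps_X; s = fps_const s1 in
           Total = (s ^ 2 * z ^ 2 + s * u * z ^ 2 + 2 * s * z ^ 3 + s ^ 2 - s * u + z * s + z ^ 2)
                     / ((z ^ 2 + 1) * (- u + s) * s))
       \<and> (let z = fps_X in
           fps_nth Total 0 = (s1 ^ 2 * z ^ 2 + 2 * s1 * z ^ 3 + s1 ^ 2 + s1 * z + z ^ 2)
                               / ((z ^ 2 + 1) * s1 ^ 2)
         \<and> (\<forall>k\<ge>1. fps_nth Total k = z * (2 * s1 ^ 2 * z + 2 * s1 * z ^ 2 + s1 + z)
                               / ((z ^ 2 + 1) * s1 ^ (k + 2))))"
proof -
  have nth_0: "fps_nth (fps_X ^ 2 + 1 :: real fps) 0 \<noteq> 0" "fps_nth s1 0 \<noteq> 0"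
    by (simp_all add: s1_nth_0)
  have bivariate: "Total = (s ^ 2 * z ^ 2 + s * u * z ^ 2 + 2 * s * z ^ 3 + s ^ 2 - s * u + z * s + z ^ 2)
                     / ((z ^ 2 + 1) * (- u + s) * s)" (is "_ = ?N / ?D")
    if "z = fps_const fps_X" "u = fps_X" "s = fps_const s1" for z u s :: "real fps fps"
  proof -
    have "(z ^ 2 + 1) * s ^ 2 = (1 - 2 * z ^ 3) * s - z ^ 2"
      using arg_cong[OF s1_quadratic, of fps_const] unfolding that
      by (simp flip: numeral_fps_const fps_const_mult fps_const_add fps_const_sub fps_const_power)
    moreover have "(z ^ 2 + 1) * (s - u) * Total = (1 + z) * (1 - (1 - z) * u)"
      unfolding that by (rule Total_rational)
    ultimately have "Total * ?D = ?N"
      by algebra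
    moreover have unit: "fps_nth (fps_nth ?D 0) 0 \<noteq> 0"
      unfolding that Total_denominator_unit by simp
    ultimately have "Total * ?D = ?N / ?D * ?D"
      by (simp add: fps_fps_divide_mult)
    moreover have "?D \<noteq> 0"
      using unit by (metis fps_zero_nth)
    ultimately show ?thesis
      by (metis mult_right_cancel)
  qed
  have height_0: "fps_nth Total 0 = (s1 ^ 2 * z ^ 2 + 2 * s1 * z ^ 3 + s1 ^ 2 + s1 * z + z ^ 2)
                               / ((z ^ 2 + 1) * s1 ^ 2)" if "z = fps_X" for z
  proof (rule fps_eq_divide_unit)
    show "fps_nth ((z ^ 2 + 1) * s1 ^ 2) 0 \<noteq> 0"
      using nth_0 that by (simp add: fps_nth_power_0)
    show "fps_nth Total 0 * ((z ^ 2 + 1) * s1 ^ 2) =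
        s1 ^ 2 * z ^ 2 + 2 * s1 * z ^ 3 + s1 ^ 2 + s1 * z + z ^ 2"
      using s1_quadratic nth_Total_recurrence(1) unfolding that by algebra
  qed
  have height_pos: "fps_nth Total k = z * (2 * s1 ^ 2 * z + 2 * s1 * z ^ 2 + s1 + z)
                               / ((z ^ 2 + 1) * s1 ^ (k + 2))" if "z = fps_X" "k \<ge> 1" for z k
  proof (rule fps_eq_divide_unit)
    show "fps_nth ((z ^ 2 + 1) * s1 ^ (k + 2)) 0 \<noteq> 0"
      using nth_0 that by (simp add: fps_nth_power_0)
    have base: "fps_nth Total 1 * ((z ^ 2 + 1) * s1 ^ 3) =
        z * (2 * s1 ^ 2 * z + 2 * s1 * z ^ 2 + s1 + z)"
      using s1_quadratic nth_Total_recurrence(1,2) unfolding that by algebra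
    have geometric: "s1 ^ l * fps_nth Total (Suc l) = fps_nth Total 1" for l
    proof (induction l)
      case (Suc l)
      show ?case
        by (simp only: power_Suc2 mult.assoc nth_Total_recurrence(3) Suc.IH)
    qed simp
    obtain l where k: "k = Suc l"
      using \<open>k \<ge> 1\<close> by (cases k) auto
    then have power: "s1 ^ (k + 2) = s1 ^ l * s1 ^ 3"
      by (simp add: power_add eval_nat_numeral mult_ac)
    then show "fps_nth Total k * ((z ^ 2 + 1) * s1 ^ (k + 2)) =
        z * (2 * s1 ^ 2 * z + 2 * s1 * z ^ 2 + s1 + z)"
      unfolding power base[symmetric] geometric[of l, symmetric] by (simp only: k mult_ac)
  qed
  show ?thesis
    unfolding Let_def using bivariate height_0 height_pos by blast
qed

end
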